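(* Let $\mathfrak{S} = \mathbb{R}^4$, let $\mathfrak{A}$ be a nonempty finite subset of $[1,2]$, let $\mathfrak{Z} = \mathfrak{S}\times\mathfrak{A}$, and let $\mathcal{H}$ be a real reproducing kernel Hilbert space of functions $\mathfrak{Z}\to\mathbb{R}$ with reproducing kernel $\kappa$. Let $\mathcal{M}$ be the set of all mappings $\mu:\mathfrak{S}\to\mathfrak{A}$. Fix a positive integer $N_{\mathrm{av}}$, states $\mathbf{s}^{\mathrm{av}}_1,\ldots,\mathbf{s}^{\mathrm{av}}_{N_{\mathrm{av}}}\in\mathfrak{S}$, functions $\psi_1,\ldots,\psi_{N_{\mathrm{av}}}\in\mathcal{H}$, a function $g\in\mathcal{H}$, and a discount factor $\alpha\geq 0$. Define $T_\mu:\mathcal{H}\to\mathcal{H}$ (for $\mu\in\mathcal{M}$) and $T:\mathcal{H}\to\mathcal{H}$ by $$T_{\mu} Q := g + \alpha \sum_{j=1}^{N_{\mathrm{av}}} Q\bigl(\mathbf{s}^{\mathrm{av}}_j, \mu(\mathbf{s}^{\mathrm{av}}_j)\bigr)\, \psi_j, \qquad TQ := g + \alpha \sum_{j=1}^{N_{\mathrm{av}}} \Bigl(\inf_{a_j \in \mathfrak{A}} Q(\mathbf{s}^{\mathrm{av}}_j, a_j)\Bigr)\, \psi_j .$$ Let $\mathbf{K}_{\Psi}$ be the $N_{\mathrm{av}}\times N_{\mathrm{av}}$ matrix with $(j,j')$ entry $\langle \psi_j, \psi_{j'}\rangle_{\mathcal{H}}$, and for $\mu\in\mathcal{M}$ let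 $\mathbf{K}^{\mathrm{av}}_{\mu}$ be the $N_{\mathrm{av}}\times N_{\mathrm{av}}$ matrix with $(j,j')$ entry $\kappa\bigl((\mathbf{s}^{\mathrm{av}}_j,\mu(\mathbf{s}^{\mathrm{av}}_j)),(\mathbf{s}^{\mathrm{av}}_{j'},\mu(\mathbf{s}^{\mathrm{av}}_{j'}))\bigr)$. Suppose that $\psi_j(\mathbf{z})\geq 0$ for all $\mathbf{z}\in\mathfrak{Z}$ and all $j\in\{1,\ldots,N_{\mathrm{av}}\}$. If $$\alpha \leq \|\mathbf{K}_{\Psi}\|^{-1/2} \Bigl(\sup_{\mu\in\mathcal{M}} \|\mathbf{K}^{\mathrm{av}}_{\mu}\|\Bigr)^{-1/2},$$ where $\|\cdot\|$ denotes the spectral norm, then for every $\mu\in\mathcal{M}$ the mapping $T_\mu$ is affine and nonexpansive on $(\mathcal{H},\langle\cdot,\cdot\rangle_{\mathcal{H}})$, and the mapping $T$ is nonexpansive on $(\mathcal{H},\langle\cdot,\cdot\rangle_{\mathcal{H}})$.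
   Context: A reproducing kernel Hilbert space $\mathcal{H}$ of functions on $\mathfrak{Z}$ with kernel $\kappa:\mathfrak{Z}\times\mathfrak{Z}\to\mathbb{R}$ satisfies $\kappa(\mathbf{z},\cdot)\in\mathcal{H}$ and $Q(\mathbf{z}) = \langle Q, \kappa(\mathbf{z},\cdot)\rangle_{\mathcal{H}}$ for all $Q\in\mathcal{H}$, $\mathbf{z}\in\mathfrak{Z}$; its norm is $\|\cdot\|_{\mathcal{H}} = \langle\cdot,\cdot\rangle_{\mathcal{H}}^{1/2}$. A mapping $F:\mathcal{H}\to\mathcal{H}$ is nonexpansive if $\|FQ-FQ'\|_{\mathcal{H}}\leq\|Q-Q'\|_{\mathcal{H}}$ for all $Q,Q'\in\mathcal{H}$. It is affine if $F(\lambda Q+(1-\lambda)Q') = \lambda FQ+(1-\lambda)FQ'$ for all $Q,Q'\in\mathcal{H}$ and all $\lambda\in\mathbb{R}$. Convention: if $\|\mathbf{K}_{\Psi}\|=0$ or $\sup_{\mu}\|\mathbf{K}^{\mathrm{av}}_{\mu}\|=0$, the right-hand side of the bound on $\alpha$ is read as $+\infty$. *)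

theory Defs
  imports "HOL-Analysis.Analysis"
begin

definition norm_of :: "(('z \<Rightarrow> real) \<Rightarrow> ('z \<Rightarrow> real) \<Rightarrow> real) \<Rightarrow> ('z \<Rightarrow> real) \<Rightarrow> real" where
  "norm_of ip f = sqrt (ip f f)"

text \<open>
  A function on the set \<open>Z\<close> is represented by the total function that agrees with it on \<open>Z\<close>
  and is \<open>0\<close> outside \<open>Z\<close>. This representation is one-to-one and compatible with pointwise
  addition and scaling. Values of \<open>ip\<close> outside \<open>H\<close> and of \<open>kappa z\<close> for \<open>z \<notin> Z\<close> are irrelevant.
\<close>

locale real_rkhs =
  fixes Z :: "'z set"
    and H :: "('z \<Rightarrow> real) set"
    and ip :: "('z \<Rightarrow> real) \<Rightarrow> ('z \<Rightarrow> real) \<Rightarrow> real"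
    and kappa :: "'z \<Rightarrow> 'z \<Rightarrow> real"
  assumes zero_outside: "f \<in> H \<Longrightarrow> z \<notin> Z \<Longrightarrow> f z = 0"
    and zero_mem: "(\<lambda>z. 0) \<in> H"
    and add_mem: "f \<in> H \<Longrightarrow> h \<in> H \<Longrightarrow> (\<lambda>z. f z + h z) \<in> H"
    and scale_mem: "f \<in> H \<Longrightarrow> (\<lambda>z. c * f z) \<in> H"
    and ip_add_left: "f \<in> H \<Longrightarrow> h \<in> H \<Longrightarrow> k \<in> H \<Longrightarrow>
      ip (\<lambda>z. f z + h z) k = ip f k + ip h k"
    and ip_scale_left: "f \<in> H \<Longrightarrow> k \<in> H \<Longrightarrow> ip (\<lambda>z. c * f z) k = c * ip f k"
    and ip_commute: "f \<in> H \<Longrightarrow> k \<in> H \<Longrightarrow> ip f k = ip k f"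
    and ip_nonneg: "f \<in> H \<Longrightarrow> 0 \<le> ip f f"
    and ip_definite: "f \<in> H \<Longrightarrow> ip f f = 0 \<Longrightarrow> f = (\<lambda>z. 0)"
    and complete: "(\<And>n::nat. X n \<in> H) \<Longrightarrow>
      (\<And>e. e > 0 \<Longrightarrow> \<exists>N. \<forall>m\<ge>N. \<forall>n\<ge>N. norm_of ip (\<lambda>z. X m z - X n z) < e) \<Longrightarrow>
      \<exists>L\<in>H. (\<lambda>n. norm_of ip (\<lambda>z. X n z - L z)) \<longlonglongrightarrow> 0"
    and kernel_mem: "z \<in> Z \<Longrightarrow> kappa z \<in> H"
    and reproducing: "f \<in> H \<Longrightarrow> z \<in> Z \<Longrightarrow> f z = ip f (kappa z)"

definition nonexpansive_map ::
    "('z \<Rightarrow> real) set \<Rightarrow> (('z \<Rightarrow> real) \<Rightarrow> ('z \<Rightarrow> real) \<Rightarrow> real) \<Rightarrow>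
     (('z \<Rightarrow> real) \<Rightarrow> ('z \<Rightarrow> real)) \<Rightarrow> bool" where
  "nonexpansive_map H ip F \<longleftrightarrow> F \<in> H \<rightarrow> H \<and>
     (\<forall>Q\<in>H. \<forall>Q'\<in>H. norm_of ip (\<lambda>z. F Q z - F Q' z) \<le> norm_of ip (\<lambda>z. Q z - Q' z))"

definition affine_map ::
    "('z \<Rightarrow> real) set \<Rightarrow> (('z \<Rightarrow> real) \<Rightarrow> ('z \<Rightarrow> real)) \<Rightarrow> bool" where
  "affine_map H F \<longleftrightarrow> F \<in> H \<rightarrow> H \<and>
     (\<forall>Q\<in>H. \<forall>Q'\<in>H. \<forall>c::real.
        F (\<lambda>z. c * Q z + (1 - c) * Q' z) = (\<lambda>z. c * F Q z + (1 - c) * F Q' z))"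

definition bellman_policy ::
    "('s \<times> 'a \<Rightarrow> real) \<Rightarrow> real \<Rightarrow> ('n::finite \<Rightarrow> 's) \<Rightarrow> ('n \<Rightarrow> 's \<times> 'a \<Rightarrow> real) \<Rightarrow>
     ('s \<Rightarrow> 'a) \<Rightarrow> ('s \<times> 'a \<Rightarrow> real) \<Rightarrow> ('s \<times> 'a \<Rightarrow> real)" where
  "bellman_policy g \<alpha> s \<psi> \<mu> Q = (\<lambda>z. g z + \<alpha> * (\<Sum>j\<in>UNIV. Q (s j, \<mu> (s j)) * \<psi> j z))"

definition bellman_opt ::
    "'a set \<Rightarrow> ('s \<times> 'a \<Rightarrow> real) \<Rightarrow> real \<Rightarrow> ('n::finite \<Rightarrow> 's) \<Rightarrow> ('n \<Rightarrow> 's \<times> 'a \<Rightarrow> real) \<Rightarrow>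
     ('s \<times> 'a \<Rightarrow> real) \<Rightarrow> ('s \<times> 'a \<Rightarrow> real)" where
  "bellman_opt A g \<alpha> s \<psi> Q = (\<lambda>z. g z + \<alpha> * (\<Sum>j\<in>UNIV. (INF a\<in>A. Q (s j, a)) * \<psi> j z))"

definition K_Psi ::
    "(('z \<Rightarrow> real) \<Rightarrow> ('z \<Rightarrow> real) \<Rightarrow> real) \<Rightarrow> ('n \<Rightarrow> 'z \<Rightarrow> real) \<Rightarrow> real^'n^'n" where
  "K_Psi ip \<psi> = (\<chi> j j'. ip (\<psi> j) (\<psi> j'))"

definition K_av ::
    "('s \<times> 'a \<Rightarrow> 's \<times> 'a \<Rightarrow> real) \<Rightarrow> ('n \<Rightarrow> 's) \<Rightarrow> ('s \<Rightarrow> 'a) \<Rightarrow> real^'n^'n" where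
  "K_av kappa s \<mu> = (\<chi> j j'. kappa (s j, \<mu> (s j)) (s j', \<mu> (s j')))"

text \<open>Operator norm induced by the Euclidean norm on \<open>real^'n\<close>.\<close>

definition spectral_norm :: "real^'n^'n \<Rightarrow> real" where
  "spectral_norm M = onorm ((*v) M)"

text \<open>The value \<open>\<infinity>\<close> is spelled out because \<open>0 powr x = 0\<close> in the library.\<close>

definition discount_bound :: "real \<Rightarrow> real \<Rightarrow> ereal" where
  "discount_bound p q =
     (if p = 0 \<or> q = 0 then \<infinity> else ereal (p powr (-1/2) * q powr (-1/2)))"

end

theory Submission
  imports Defs
begin

text \<open>
  Let \<open>D = Q - Q'\<close> and choose a policy \<open>\<mu>\<close> for which \<open>\<mu>(s)\<close> maximises \<open>\<bar>D(s, a)\<bar>\<close> over \<open>a \<in> A\<close>.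
  The difference of the two infima at \<open>s\<^sub>j\<close> is then at most \<open>\<bar>D(s\<^sub>j, \<mu>(s\<^sub>j))\<bar>\<close> in absolute value,
  so \<open>TQ - TQ'\<close> and \<open>T\<^sub>\<mu>Q - T\<^sub>\<mu>Q'\<close> are both of the form \<open>\<alpha> \<Sum>\<^sub>j c\<^sub>j \<psi>\<^sub>j\<close> with a coefficient vector
  dominated entrywise by the samples \<open>d\<^sub>j = D(s\<^sub>j, \<mu>(s\<^sub>j))\<close>. Its squared norm is at most
  \<open>\<alpha>\<^sup>2 \<parallel>K\<^sub>\<Psi>\<parallel> \<bar>d\<bar>\<^sup>2\<close>. Finally \<open>\<bar>d\<bar>\<^sup>2 = \<langle>D, \<Sum>\<^sub>j d\<^sub>j \<kappa>(z\<^sub>j, \<cdot>)\<rangle>\<close> by reproduction, and Cauchy--Schwarz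
  gives \<open>\<bar>d\<bar>\<^sup>2 \<le> \<parallel>K\<^sub>\<mu>\<parallel> \<parallel>D\<parallel>\<^sup>2\<close>.
\<close>

lemma spectral_norm_nonneg: "0 \<le> spectral_norm M"
  unfolding spectral_norm_def by (intro onorm_pos_le matrix_vector_mul_bounded_linear)

lemma quadratic_form_le_spectral_norm: "c \<bullet> (M *v c) \<le> spectral_norm M * (norm c)\<^sup>2"
proof -
  have "norm (M *v c) \<le> spectral_norm M * norm c"
    unfolding spectral_norm_def by (intro onorm matrix_vector_mul_bounded_linear)
  then have "norm c * norm (M *v c) \<le> norm c * (spectral_norm M * norm c)"
    by (intro mult_left_mono) auto
  moreover have "c \<bullet> (M *v c) \<le> norm c * norm (M *v c)"
    by (rule norm_cauchy_schwarz)
  ultimately show ?thesis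
    by (simp add: power2_eq_square mult.commute mult.left_commute)
qed

text \<open>Taking an infimum is nonexpansive for the sup distance: lowering the infimum of one
  function by \<open>e\<close> gives a lower bound of the other, and the roles can be exchanged.
  Finiteness of \<open>A\<close> makes the infima genuine lower bounds.\<close>

lemma abs_INF_diff_le:
  fixes f h :: "'a \<Rightarrow> real"
  assumes "finite A" "A \<noteq> {}" and le: "\<And>a. a \<in> A \<Longrightarrow> \<bar>f a - h a\<bar> \<le> e"
  shows "\<bar>(INF a\<in>A. f a) - (INF a\<in>A. h a)\<bar> \<le> e"
proof -
  have *: "(INF a\<in>A. u a) - e \<le> (INF a\<in>A. v a)"
    if "\<And>a. a \<in> A \<Longrightarrow> \<bar>u a - v a\<bar> \<le> e" for u v :: "'a \<Rightarrow> real"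
  proof (rule cINF_greatest[OF \<open>A \<noteq> {}\<close>])
    fix a assume a: "a \<in> A"
    have "(INF a\<in>A. u a) \<le> u a"
      using a \<open>finite A\<close> by (intro cINF_lower) auto
    then show "(INF a\<in>A. u a) - e \<le> v a" using that[OF a] by linarith
  qed
  have "(INF a\<in>A. f a) - e \<le> (INF a\<in>A. h a)" using le by (rule *)
  moreover have "(INF a\<in>A. h a) - e \<le> (INF a\<in>A. f a)"
    using le by (intro *) (metis abs_minus_commute)
  ultimately show ?thesis by linarith
qed

text \<open>The product form needs no convention for vanishing norms: where
  \<open>discount_bound\<close> is infinite, the left-hand side is \<open>0\<close>.\<close>

lemma discount_bound_square:
  assumes "0 \<le> p" "0 \<le> q" "0 \<le> \<alpha>" and le: "ereal \<alpha> \<le> discount_bound p q"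
  shows "\<alpha>\<^sup>2 * p * q \<le> 1"
proof (cases "p = 0 \<or> q = 0")
  case True
  then show ?thesis by auto
next
  case False
  then have pos: "0 < p" "0 < q" using assms by auto
  have "\<alpha> \<le> p powr (-1/2) * q powr (-1/2)"
    using le False by (simp add: discount_bound_def)
  also have "\<dots> = 1 / sqrt (p * q)"
    using pos by (simp add: powr_minus powr_half_sqrt real_sqrt_mult field_simps)
  finally have "\<alpha> * sqrt (p * q) \<le> 1"
    using pos by (simp add: field_simps)
  then have "(\<alpha> * sqrt (p * q))\<^sup>2 \<le> 1"
    using assms by (simp add: power_le_one)
  then show ?thesis using pos by (simp add: power_mult_distrib mult.assoc)
qed

text \<open>There are infinitely many policies, but \<open>K_av\<close> sees a policy only through
  its values at the finitely many states \<open>s j\<close>, so only finitely many matrices occur.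
  Without boundedness the real-valued \<open>SUP\<close> in the theorem would not dominate its
  members.\<close>

lemma bdd_above_spectral_norm_K_av:
  fixes s :: "'n::finite \<Rightarrow> 's"
  assumes "finite (A :: 'a set)"
  shows "bdd_above ((\<lambda>\<mu>. spectral_norm (K_av kappa s \<mu>)) ` (UNIV \<rightarrow> A))"
proof -
  let ?K = "\<lambda>b. spectral_norm (\<chi> j j'. kappa (s j, b j) (s j', b j'))"
  have "(\<lambda>\<mu>. spectral_norm (K_av kappa s \<mu>)) ` (UNIV \<rightarrow> A) \<subseteq> ?K ` (UNIV \<rightarrow>\<^sub>E A)"
  proof (rule image_subsetI)
    fix \<mu> :: "'s \<Rightarrow> 'a"
    assume "\<mu> \<in> UNIV \<rightarrow> A"
    then show "spectral_norm (K_av kappa s \<mu>) \<in> ?K ` (UNIV \<rightarrow>\<^sub>E A)"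
      by (intro image_eqI[where x = "\<lambda>j. \<mu> (s j)"]) (auto simp: K_av_def)
  qed
  moreover have "finite ((UNIV :: 'n set) \<rightarrow>\<^sub>E A)"
    using assms by (intro finite_PiE) auto
  ultimately show ?thesis
    by (meson bdd_above_finite finite_imageI finite_subset)
qed

section \<open>Inner product calculus and norm estimates in the function space\<close>

context real_rkhs
begin

lemma sum_mem:
  assumes "finite I" "\<And>i. i \<in> I \<Longrightarrow> f i \<in> H"
  shows "(\<lambda>z. \<Sum>i\<in>I. c i * f i z) \<in> H"
  using assms
proof (induction I)
  case empty
  then show ?case by (simp add: zero_mem)
next
  case (insert i I)
  then show ?case using add_mem[OF scale_mem[of "f i" "c i"]] by simp
qed

lemma diff_mem: "f \<in> H \<Longrightarrow> h \<in> H \<Longrightarrow> (\<lambda>z. f z - h z) \<in> H"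
  using add_mem[of f "\<lambda>z. - 1 * h z"] scale_mem[of h "-1"] by simp

lemma ip_zero_left: "k \<in> H \<Longrightarrow> ip (\<lambda>z. 0) k = 0"
  using ip_scale_left[OF zero_mem, of k 0] by simp

lemma ip_sum_left:
  assumes "finite I" "\<And>i. i \<in> I \<Longrightarrow> f i \<in> H" "k \<in> H"
  shows "ip (\<lambda>z. \<Sum>i\<in>I. c i * f i z) k = (\<Sum>i\<in>I. c i * ip (f i) k)"
  using assms
proof (induction I)
  case empty
  then show ?case by (simp add: ip_zero_left)
next
  case (insert i I)
  then show ?case
    using ip_add_left[OF scale_mem[of "f i" "c i"] sum_mem[of I f c], of k]
    by (simp add: ip_scale_left)
qed

lemma ip_sum_right:
  assumes "finite I" "\<And>i. i \<in> I \<Longrightarrow> f i \<in> H" "k \<in> H"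
  shows "ip k (\<lambda>z. \<Sum>i\<in>I. c i * f i z) = (\<Sum>i\<in>I. c i * ip k (f i))"
  using assms by (simp add: ip_commute[of k] sum_mem ip_sum_left)

lemma ip_scale_scale: "f \<in> H \<Longrightarrow> ip (\<lambda>z. c * f z) (\<lambda>z. c * f z) = c\<^sup>2 * ip f f"
  using ip_commute[of f "\<lambda>z. c * f z"]
  by (simp add: ip_scale_left scale_mem power2_eq_square)

lemma ip_Cauchy_Schwarz:
  assumes f: "f \<in> H" and k: "k \<in> H"
  shows "(ip f k)\<^sup>2 \<le> ip f f * ip k k"
proof (cases "ip k k = 0")
  case True
  then have "k = (\<lambda>z. 0)" using ip_definite k by blast
  then show ?thesis using ip_zero_left[OF f] ip_zero_left[OF k] ip_commute[OF f k] by simp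
next
  case False
  then have pos: "0 < ip k k" using ip_nonneg[OF k] by simp
  \<comment> \<open>With this factor \<open>?r\<close> is the component of \<open>f\<close>
    orthogonal to \<open>k\<close>; the inequality is the nonnegativity of its squared norm.\<close>
  let ?t = "- (ip f k / ip k k)"
  let ?r = "\<lambda>z. f z + ?t * k z"
  have tk: "(\<lambda>z. ?t * k z) \<in> H" using k by (rule scale_mem)
  have r: "?r \<in> H" using f tk by (rule add_mem)
  have expand: "ip ?r h = ip f h + ?t * ip k h" if "h \<in> H" for h
    by (subst ip_add_left[OF f tk that]) (subst ip_scale_left[OF k that], rule refl)
  have "ip ?r k = 0" using expand[OF k] False by simp
  then have rk: "ip k ?r = 0" using ip_commute[OF k r] by simp
  have "0 \<le> ip ?r ?r" by (rule ip_nonneg[OF r])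
  also have "ip ?r ?r = ip f ?r" using expand[OF r] rk by simp
  also have "\<dots> = ip f f + ?t * ip k f" using ip_commute[OF f r] expand[OF f] by simp
  also have "\<dots> = ip f f - (ip f k)\<^sup>2 / ip k k"
    using ip_commute[OF f k] by (simp add: power2_eq_square)
  finally show ?thesis using pos by (simp add: field_simps)
qed

text \<open>By bilinearity the squared norm is the quadratic form of the Gram matrix at
  \<open>c\<close>. It is applied both to the functions \<open>\<psi>\<close> and to the kernel
  sections \<open>kappa (z j)\<close>.\<close>

lemma ip_combination_le:
  fixes c :: "real^'n::finite"
  assumes f: "\<And>j. f j \<in> H"
  shows "ip (\<lambda>z. \<Sum>j\<in>UNIV. c $ j * f j z) (\<lambda>z. \<Sum>j\<in>UNIV. c $ j * f j z)
    \<le> spectral_norm (K_Psi ip f) * (norm c)\<^sup>2"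
proof -
  have "ip (\<lambda>z. \<Sum>j\<in>UNIV. c $ j * f j z) (\<lambda>z. \<Sum>j\<in>UNIV. c $ j * f j z)
      = c \<bullet> (K_Psi ip f *v c)"
    using f by (simp add: ip_sum_left ip_sum_right sum_mem K_Psi_def inner_vec_def
        matrix_vector_mult_def mult.commute)
  then show ?thesis using quadratic_form_le_spectral_norm by metis
qed

text \<open>The map from \<open>d\<close> to \<open>L\<close> below is the adjoint of sampling at
  the points \<open>z j\<close>, so pairing \<open>D\<close> with \<open>L\<close> returns the
  squared length of the sample vector.\<close>

lemma samples_norm_le:
  fixes z :: "'n::finite \<Rightarrow> 'z"
  assumes D: "D \<in> H" and z: "\<And>j. z j \<in> Z"
  shows "(norm (\<chi> j. D (z j)))\<^sup>2
    \<le> spectral_norm (\<chi> j j'. kappa (z j) (z j')) * ip D D"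
proof -
  define d where "d = (\<chi> j. D (z j))"
  define L where "L = (\<lambda>w. \<Sum>j\<in>UNIV. d $ j * kappa (z j) w)"
  let ?K = "(\<chi> j j'. kappa (z j) (z j')) :: real^'n^'n"
  have ker: "\<And>j. kappa (z j) \<in> H" using z by (rule kernel_mem)
  have L: "L \<in> H" unfolding L_def using ker by (intro sum_mem) auto
  \<comment> \<open>The kernel matrix is the Gram matrix of its own sections, by the reproducing
    property.\<close>
  have "K_Psi ip (\<lambda>j. kappa (z j)) = ?K"
    unfolding K_Psi_def using reproducing[OF ker z] by simp
  then have LL: "ip L L \<le> spectral_norm ?K * (norm d)\<^sup>2"
    unfolding L_def using ip_combination_le[of "\<lambda>j. kappa (z j)" d] ker by simp
  have "ip D L = (\<Sum>j\<in>UNIV. d $ j * ip D (kappa (z j)))"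
    unfolding L_def using ker D by (intro ip_sum_right) auto
  also have "\<dots> = (norm d)\<^sup>2"
    using reproducing[OF D z]
    by (simp add: d_def power2_norm_eq_inner inner_vec_def)
  finally have "((norm d)\<^sup>2)\<^sup>2 \<le> ip D D * ip L L"
    using ip_Cauchy_Schwarz[OF D L] by simp
  also have "\<dots> \<le> ip D D * (spectral_norm ?K * (norm d)\<^sup>2)"
    by (rule mult_left_mono[OF LL ip_nonneg[OF D]])
  finally have *: "(norm d)\<^sup>2 * (norm d)\<^sup>2 \<le> (spectral_norm ?K * ip D D) * (norm d)\<^sup>2"
    by (simp add: power2_eq_square mult_ac)
  have "(norm d)\<^sup>2 \<le> spectral_norm ?K * ip D D"
  \<comment> \<open>The factor \<open>(norm d)\<^sup>2\<close> can be cancelled only when it is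
    positive.\<close>
  proof (cases "d = 0")
    case True
    then show ?thesis
      using mult_nonneg_nonneg[OF spectral_norm_nonneg ip_nonneg[OF D]] by simp
  next
    case False
    then show ?thesis by (intro mult_right_le_imp_le[OF *]) simp
  qed
  then show ?thesis unfolding d_def .
qed

text \<open>Only domination of \<open>c\<close> by the samples is required, since differences of
  infima are not themselves samples of \<open>D\<close>.\<close>

lemma combination_norm_le:
  fixes z :: "'n::finite \<Rightarrow> 'z"
  assumes D: "D \<in> H" and z: "\<And>j. z j \<in> Z" and \<psi>: "\<And>j. \<psi> j \<in> H"
    and dom: "\<And>j. \<bar>c j\<bar> \<le> \<bar>D (z j)\<bar>"
    and \<alpha>: "\<alpha>\<^sup>2 * spectral_norm (K_Psi ip \<psi>)
      * spectral_norm (\<chi> j j'. kappa (z j) (z j')) \<le> 1"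
  shows "norm_of ip (\<lambda>w. \<alpha> * (\<Sum>j\<in>UNIV. c j * \<psi> j w)) \<le> norm_of ip D"
proof -
  let ?p = "spectral_norm (K_Psi ip \<psi>)"
  let ?q = "spectral_norm (\<chi> j j'. kappa (z j) (z j'))"
  let ?f = "\<lambda>w. \<Sum>j\<in>UNIV. c j * \<psi> j w"
  have "?f \<in> H" using \<psi> by (intro sum_mem) auto
  then have "ip (\<lambda>w. \<alpha> * ?f w) (\<lambda>w. \<alpha> * ?f w) = \<alpha>\<^sup>2 * ip ?f ?f"
    by (rule ip_scale_scale)
  also have "\<dots> \<le> \<alpha>\<^sup>2 * (?p * (norm (\<chi> j. c j))\<^sup>2)"
    using ip_combination_le[of \<psi> "\<chi> j. c j"] \<psi> by (intro mult_left_mono) auto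
  also have "\<dots> \<le> \<alpha>\<^sup>2 * (?p * (?q * ip D D))"
  proof -
    have "norm (\<chi> j. c j) \<le> norm (\<chi> j. D (z j))"
      using dom by (intro norm_le_componentwise_cart) simp
    then have "(norm (\<chi> j. c j))\<^sup>2 \<le> (norm (\<chi> j. D (z j)))\<^sup>2"
      by (intro power_mono) auto
    also have "\<dots> \<le> ?q * ip D D" using D z by (rule samples_norm_le)
    finally show ?thesis by (intro mult_left_mono spectral_norm_nonneg) auto
  qed
  also have "\<dots> = (\<alpha>\<^sup>2 * ?p * ?q) * ip D D" by (simp add: mult_ac)
  also have "\<dots> \<le> 1 * ip D D" by (rule mult_right_mono[OF \<alpha> ip_nonneg[OF D]])
  finally show ?thesis by (simp add: norm_of_def)
qed

lemma affine_combination_mem: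
  assumes "g \<in> H" "\<And>j. \<psi> j \<in> H"
  shows "(\<lambda>w. g w + \<alpha> * (\<Sum>j\<in>(UNIV :: 'n::finite set). c j * \<psi> j w)) \<in> H"
  by (rule add_mem[OF assms(1) scale_mem[OF sum_mem]]) (simp_all add: assms(2))

end

theorem theorem1:
  fixes A :: "real set"
    and H :: "((real^4) \<times> real \<Rightarrow> real) set"
    and ip :: "((real^4) \<times> real \<Rightarrow> real) \<Rightarrow> ((real^4) \<times> real \<Rightarrow> real) \<Rightarrow> real"
    and kappa :: "(real^4) \<times> real \<Rightarrow> (real^4) \<times> real \<Rightarrow> real"
    and s :: "'n::finite \<Rightarrow> real^4"
    and \<psi> :: "'n \<Rightarrow> (real^4) \<times> real \<Rightarrow> real"
    and g :: "(real^4) \<times> real \<Rightarrow> real"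
    and \<alpha> :: real
  assumes "A \<noteq> {}" and "finite A" and "A \<subseteq> {1..2}"
    and "real_rkhs (UNIV \<times> A) H ip kappa"
    and "\<And>j. \<psi> j \<in> H" and "g \<in> H" and "0 \<le> \<alpha>"
    and "\<And>j z. z \<in> UNIV \<times> A \<Longrightarrow> 0 \<le> \<psi> j z"
    and "ereal \<alpha> \<le> discount_bound (spectral_norm (K_Psi ip \<psi>))
           (SUP \<mu>\<in>UNIV \<rightarrow> A. spectral_norm (K_av kappa s \<mu>))"
  shows "(\<forall>\<mu>\<in>UNIV \<rightarrow> A. affine_map H (bellman_policy g \<alpha> s \<psi> \<mu>) \<and>
            nonexpansive_map H ip (bellman_policy g \<alpha> s \<psi> \<mu>)) \<and>
         nonexpansive_map H ip (bellman_opt A g \<alpha> s \<psi>)"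
proof -
  interpret real_rkhs "UNIV \<times> A" H ip kappa by fact
  note \<psi> = \<open>\<And>j. \<psi> j \<in> H\<close>
  let ?p = "spectral_norm (K_Psi ip \<psi>)"
  let ?q = "\<lambda>\<mu>. spectral_norm (K_av kappa s \<mu>)"
  let ?S = "SUP \<mu>\<in>UNIV \<rightarrow> A. ?q \<mu>"
  have q_le: "?q \<mu> \<le> ?S" if "\<mu> \<in> UNIV \<rightarrow> A" for \<mu> :: "real^4 \<Rightarrow> real"
    using that bdd_above_spectral_norm_K_av[OF \<open>finite A\<close>] by (rule cSUP_upper)
  \<comment> \<open>A constant policy shows that the supremum is over a nonempty family, hence
    nonnegative.\<close>
  obtain a0 where "a0 \<in> A" using \<open>A \<noteq> {}\<close> by blast
  then have "?q (\<lambda>_. a0) \<le> ?S" by (intro q_le) simp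
  then have S_nonneg: "0 \<le> ?S" by (rule order_trans[OF spectral_norm_nonneg])
  have "\<alpha>\<^sup>2 * ?p * ?S \<le> 1"
    by (rule discount_bound_square) (fact spectral_norm_nonneg S_nonneg assms)+
  then have small: "\<alpha>\<^sup>2 * ?p * ?q \<mu> \<le> 1" if "\<mu> \<in> UNIV \<rightarrow> A" for \<mu> :: "real^4 \<Rightarrow> real"
    by (rule order_trans[rotated])
      (intro mult_left_mono q_le that mult_nonneg_nonneg spectral_norm_nonneg zero_le_power2)
  have bound: "norm_of ip (\<lambda>w. \<alpha> * (\<Sum>j\<in>UNIV. c j * \<psi> j w)) \<le> norm_of ip D"
    if "\<mu> \<in> UNIV \<rightarrow> A" "D \<in> H" "\<And>j. \<bar>c j\<bar> \<le> \<bar>D (s j, \<mu> (s j))\<bar>" for \<mu> :: "real^4 \<Rightarrow> real" and D c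
    using that small[OF that(1)] \<psi>
    by (intro combination_norm_le[where z = "\<lambda>j. (s j, \<mu> (s j))"]) (auto simp: K_av_def)
  \<comment> \<open>Both operators have this shape, with sampled values or infima as coefficients;
    \<open>g\<close> cancels in the difference.\<close>
  have diff: "norm_of ip (\<lambda>w. (g w + \<alpha> * (\<Sum>j\<in>UNIV. c j * \<psi> j w))
        - (g w + \<alpha> * (\<Sum>j\<in>UNIV. c' j * \<psi> j w))) \<le> norm_of ip (\<lambda>w. Q w - Q' w)"
    if "\<mu> \<in> UNIV \<rightarrow> A" "Q \<in> H" "Q' \<in> H"
      "\<And>j. \<bar>c j - c' j\<bar> \<le> \<bar>Q (s j, \<mu> (s j)) - Q' (s j, \<mu> (s j))\<bar>" for \<mu> :: "real^4 \<Rightarrow> real" and Q Q' c c'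
    using bound[OF that(1) diff_mem[OF that(2,3)], of "\<lambda>j. c j - c' j"] that(4)
    by (simp add: left_diff_distrib sum_subtractf right_diff_distrib)
  show ?thesis
  proof (intro conjI ballI)
    fix \<mu> :: "real^4 \<Rightarrow> real"
    assume \<mu>: "\<mu> \<in> UNIV \<rightarrow> A"
    have maps: "bellman_policy g \<alpha> s \<psi> \<mu> \<in> H \<rightarrow> H"
      unfolding bellman_policy_def using \<open>g \<in> H\<close> \<psi> by (intro Pi_I affine_combination_mem)
    have "bellman_policy g \<alpha> s \<psi> \<mu> (\<lambda>z. c * Q z + (1 - c) * Q' z)
        = (\<lambda>z. c * bellman_policy g \<alpha> s \<psi> \<mu> Q z + (1 - c) * bellman_policy g \<alpha> s \<psi> \<mu> Q' z)"
      for c Q Q'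
    proof
      fix z
      let ?v = "\<lambda>Q. \<Sum>j\<in>UNIV. Q (s j, \<mu> (s j)) * \<psi> j z"
      have "?v (\<lambda>z. c * Q z + (1 - c) * Q' z) = c * ?v Q + (1 - c) * ?v Q'"
        by (simp add: distrib_right sum.distrib sum_distrib_left mult.assoc)
      then show "bellman_policy g \<alpha> s \<psi> \<mu> (\<lambda>z. c * Q z + (1 - c) * Q' z) z
          = c * bellman_policy g \<alpha> s \<psi> \<mu> Q z + (1 - c) * bellman_policy g \<alpha> s \<psi> \<mu> Q' z"
        \<comment> \<open>The weights \<open>c\<close> and \<open>1 - c\<close> sum to
          \<open>1\<close>, so the offset \<open>g z\<close> is reproduced.\<close>
        unfolding bellman_policy_def by (simp only:) (simp add: algebra_simps)
    qed
    with maps show "affine_map H (bellman_policy g \<alpha> s \<psi> \<mu>)"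
      unfolding affine_map_def by blast
    show "nonexpansive_map H ip (bellman_policy g \<alpha> s \<psi> \<mu>)"
      unfolding nonexpansive_map_def
    proof (intro conjI ballI maps)
      fix Q Q' assume "Q \<in> H" "Q' \<in> H"
      with \<mu> show "norm_of ip (\<lambda>z. bellman_policy g \<alpha> s \<psi> \<mu> Q z - bellman_policy g \<alpha> s \<psi> \<mu> Q' z)
          \<le> norm_of ip (\<lambda>z. Q z - Q' z)"
        \<comment> \<open>Here the domination required by \<open>diff\<close> is an
          equality.\<close>
        unfolding bellman_policy_def by (rule diff) simp
    qed
  next
    show "nonexpansive_map H ip (bellman_opt A g \<alpha> s \<psi>)"
      unfolding nonexpansive_map_def
    proof (intro conjI ballI)
      show "bellman_opt A g \<alpha> s \<psi> \<in> H \<rightarrow> H"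
        unfolding bellman_opt_def using \<open>g \<in> H\<close> \<psi> by (intro Pi_I affine_combination_mem)
      fix Q Q' assume Q: "Q \<in> H" "Q' \<in> H"
      \<comment> \<open>A maximising action exists at every state because \<open>A\<close> is finite
        and nonempty. The resulting policy depends on \<open>Q\<close> and \<open>Q'\<close>, which
        is why a bound uniform over all policies is used.\<close>
      have "\<exists>a\<in>A. \<forall>b\<in>A. \<bar>Q (x, b) - Q' (x, b)\<bar> \<le> \<bar>Q (x, a) - Q' (x, a)\<bar>" for x
      proof -
        obtain a where "a \<in> A"
          and "\<bar>Q (x, a) - Q' (x, a)\<bar> = (MAX b\<in>A. \<bar>Q (x, b) - Q' (x, b)\<bar>)"
          by (rule obtains_MAX[OF \<open>finite A\<close> \<open>A \<noteq> {}\<close>, of "\<lambda>b. \<bar>Q (x, b) - Q' (x, b)\<bar>"]) auto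
        then show ?thesis using \<open>finite A\<close> by (intro bexI[of _ a]) simp_all
      qed
      then obtain \<mu> where \<mu>: "\<And>x. \<mu> x \<in> A"
        and max: "\<And>x b. b \<in> A \<Longrightarrow> \<bar>Q (x, b) - Q' (x, b)\<bar> \<le> \<bar>Q (x, \<mu> x) - Q' (x, \<mu> x)\<bar>"
        by metis
      from \<mu> have "\<mu> \<in> UNIV \<rightarrow> A" by simp
      from this Q
      show "norm_of ip (\<lambda>z. bellman_opt A g \<alpha> s \<psi> Q z - bellman_opt A g \<alpha> s \<psi> Q' z)
          \<le> norm_of ip (\<lambda>z. Q z - Q' z)"
        unfolding bellman_opt_def
        by (rule diff) (intro abs_INF_diff_le \<open>finite A\<close> \<open>A \<noteq> {}\<close> max)
    qed
  qed
qed

end
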